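(* Let $\mathbf{x}_1,\dots,\mathbf{x}_m\in\mathbb{R}^n$, $\mathbf{y}\in\{-1,1\}^m$, $0<c<C$ and $s\in\{1,\dots,m\}$. Then global minimizers of the problem $$\min_{\boldsymbol\alpha\in\mathbb{R}^m} D(\boldsymbol\alpha)\quad\text{s.t.}\quad \sum_{i=1}^m\alpha_iy_i=0,\ \ \|\boldsymbol\alpha\|_0\le s$$ exist.
   Context: $D(\boldsymbol\alpha)=\frac12\sum_{i,j=1}^m\alpha_i\alpha_jy_iy_j\langle\mathbf{x}_i,\mathbf{x}_j\rangle-\sum_{i=1}^m\alpha_i+\sum_{i=1}^m h_{cC}(\alpha_i)$, where $h_{cC}(t)=t^2/(2C)$ for $t\ge0$ and $h_{cC}(t)=t^2/(2c)$ for $t<0$. $\|\boldsymbol\alpha\|_0$ is the number of nonzero entries of $\boldsymbol\alpha$. *)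

theory Defs
  imports "HOL-Analysis.Analysis"
begin

definition h :: "real \<Rightarrow> real \<Rightarrow> real \<Rightarrow> real" where
  "h c C t = (if t \<ge> 0 then t\<^sup>2 / (2 * C) else t\<^sup>2 / (2 * c))"

text \<open>The number of samples is \<open>CARD('m)\<close>; \<open>x i\<close> is the \<open>i\<close>-th sample and \<open>y $ i\<close> its label.\<close>

definition D ::
  "real \<Rightarrow> real \<Rightarrow> ('m::finite \<Rightarrow> real ^ 'n) \<Rightarrow> real ^ 'm \<Rightarrow> real ^ 'm \<Rightarrow> real" where
  "D c C x y \<alpha> =
     1 / 2 * (\<Sum>i\<in>UNIV. \<Sum>j\<in>UNIV. \<alpha> $ i * \<alpha> $ j * y $ i * y $ j * (x i \<bullet> x j))
     - (\<Sum>i\<in>UNIV. \<alpha> $ i) + (\<Sum>i\<in>UNIV. h c C (\<alpha> $ i))"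

definition l0_norm :: "real ^ 'm \<Rightarrow> nat" where
  "l0_norm \<alpha> = card {i. \<alpha> $ i \<noteq> 0}"

definition feasible :: "real ^ 'm \<Rightarrow> nat \<Rightarrow> real ^ 'm \<Rightarrow> bool" where
  "feasible y s \<alpha> \<longleftrightarrow> (\<Sum>i\<in>UNIV. \<alpha> $ i * y $ i) = 0 \<and> l0_norm \<alpha> \<le> s"

end

theory Submission
  imports Defs
begin

text \<open>The quadratic form in \<open>D\<close> is the square of a norm and \<open>h c C t \<ge> t\<^sup>2 / (2 * C)\<close>, so completing
  the square shows that \<open>D\<close> is nonpositive only in a ball centred at the point \<open>(C, \<dots>, C)\<close>. Since
  \<open>D\<close> is continuous and vanishes at the feasible point \<open>0\<close>, it suffices that the feasible set is
  closed, which holds because the sparsity constraint describes a finite union of coordinate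
  subspaces.\<close>

lemma h_ge:
  assumes "0 < c" "c < C"
  shows "t\<^sup>2 / (2 * C) \<le> h c C t"
  using assms divide_left_mono[of "2 * c" "2 * C" "t\<^sup>2"] by (simp add: h_def)

text \<open>Both branches vanish at 0, so \<open>h\<close> splits into a parabola in the positive
  part of \<open>t\<close> plus one in the negative part, which removes the case
  distinction.\<close>

lemma continuous_on_h [continuous_intros]:
  assumes "continuous_on S f"
  shows "continuous_on S (\<lambda>a. h c C (f a))"
proof -
  \<comment> \<open>Naming the coefficients \<open>u\<close> and \<open>v\<close> turns the
    divisions into products with constants, so no condition that \<open>c\<close> or
    \<open>C\<close> is nonzero arises.\<close>
  have "h c C t = (max t 0)\<^sup>2 * u + (min t 0)\<^sup>2 * v" if "u = 1 / (2 * C)" "v = 1 / (2 * c)" for t u v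
    using that by (simp add: h_def max_def min_def)
  then obtain u v where h: "\<And>t. h c C t = (max t 0)\<^sup>2 * u + (min t 0)\<^sup>2 * v"
    by blast
  show ?thesis
    unfolding h by (intro continuous_intros assms)
qed

lemma continuous_on_D: "continuous_on S (D c C x y)"
  unfolding D_def by (intro continuous_intros)

lemma quadratic_form_eq_norm:
  fixes x :: "'m::finite \<Rightarrow> real ^ 'n" and y \<alpha> :: "real ^ 'm"
  shows "(\<Sum>i\<in>UNIV. \<Sum>j\<in>UNIV. \<alpha> $ i * \<alpha> $ j * y $ i * y $ j * (x i \<bullet> x j))
    = (norm (\<Sum>i\<in>UNIV. (\<alpha> $ i * y $ i) *\<^sub>R x i))\<^sup>2"
  unfolding power2_norm_eq_inner inner_sum_left inner_sum_right
  by (intro sum.cong refl) (simp add: mult_ac inner_commute)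

lemma D_nonpos_bounded:
  fixes x :: "'m::finite \<Rightarrow> real ^ 'n" and y \<alpha> :: "real ^ 'm"
  assumes "0 < c" "c < C" "D c C x y \<alpha> \<le> 0"
  shows "\<alpha> \<in> cball (\<chi> i. C) (sqrt (real CARD('m) * C\<^sup>2))"
proof -
  have C: "C > 0" using assms by simp
  have "(\<Sum>i\<in>UNIV. (\<alpha> $ i)\<^sup>2 / (2 * C)) \<le> (\<Sum>i\<in>UNIV. h c C (\<alpha> $ i))"
    by (intro sum_mono h_ge assms)
  \<comment> \<open>The squared norm is nonnegative; dropping it decouples the coordinates.\<close>
  then have "(\<Sum>i\<in>UNIV. (\<alpha> $ i)\<^sup>2 / (2 * C)) - (\<Sum>i\<in>UNIV. \<alpha> $ i) \<le> 0"
    using assms(3) zero_le_power2[of "norm (\<Sum>i\<in>UNIV. (\<alpha> $ i * y $ i) *\<^sub>R x i)"]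
    unfolding D_def quadratic_form_eq_norm by linarith
  then have "2 * C * ((\<Sum>i\<in>UNIV. (\<alpha> $ i)\<^sup>2 / (2 * C)) - (\<Sum>i\<in>UNIV. \<alpha> $ i)) \<le> 0"
    using C by (simp add: mult_le_0_iff)
  \<comment> \<open>Each coordinate contributes \<open>C\<^sup>2\<close> on completing the square;
    these sum to the squared radius.\<close>
  moreover have "(C - \<alpha> $ i)\<^sup>2 = 2 * C * ((\<alpha> $ i)\<^sup>2 / (2 * C) - \<alpha> $ i) + C\<^sup>2" for i
    using C by (simp add: power2_diff right_diff_distrib)
  then have "(\<Sum>i\<in>UNIV. (C - \<alpha> $ i)\<^sup>2) =
      2 * C * ((\<Sum>i\<in>UNIV. (\<alpha> $ i)\<^sup>2 / (2 * C)) - (\<Sum>i\<in>UNIV. \<alpha> $ i)) + real CARD('m) * C\<^sup>2"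
    by (simp only: sum.distrib sum_distrib_left[symmetric] sum_subtractf sum_constant)
  ultimately have "(\<Sum>i\<in>UNIV. (C - \<alpha> $ i)\<^sup>2) \<le> real CARD('m) * C\<^sup>2"
    by simp
  then show ?thesis
    by (simp add: dist_norm norm_vec_def L2_set_def)
qed

lemma closed_l0_norm_le: "closed {\<alpha> :: real ^ 'm::finite. l0_norm \<alpha> \<le> s}"
proof -
  \<comment> \<open>Asking only that \<open>A\<close> contain the support, not equal it, makes each
    piece a closed subspace.\<close>
  have "{\<alpha> :: real ^ 'm. l0_norm \<alpha> \<le> s} = (\<Union>A\<in>{A. card A \<le> s}. {\<alpha>. \<forall>i. i \<notin> A \<longrightarrow> \<alpha> $ i = 0})"
  proof (intro set_eqI iffI)
    fix \<alpha> :: "real ^ 'm"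
    assume "\<alpha> \<in> {\<alpha>. l0_norm \<alpha> \<le> s}"
    then show "\<alpha> \<in> (\<Union>A\<in>{A. card A \<le> s}. {\<alpha>. \<forall>i. i \<notin> A \<longrightarrow> \<alpha> $ i = 0})"
      by (auto simp: l0_norm_def intro!: exI[of _ "{i. \<alpha> $ i \<noteq> 0}"])
  next
    fix \<alpha> :: "real ^ 'm"
    assume "\<alpha> \<in> (\<Union>A\<in>{A. card A \<le> s}. {\<alpha>. \<forall>i. i \<notin> A \<longrightarrow> \<alpha> $ i = 0})"
    then obtain A where A: "card A \<le> s" "{i. \<alpha> $ i \<noteq> 0} \<subseteq> A" by auto
    then show "\<alpha> \<in> {\<alpha>. l0_norm \<alpha> \<le> s}"
      using card_mono[OF finite A(2)] by (simp add: l0_norm_def)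
  qed
  moreover have "closed {\<alpha> :: real ^ 'm. \<forall>i. i \<notin> A \<longrightarrow> \<alpha> $ i = 0}" for A
    by (intro closed_Collect_all closed_Collect_imp closed_Collect_eq open_Collect_const
        continuous_intros)
  ultimately show ?thesis
    by (auto intro!: closed_UN)
qed

lemma closed_feasible: "closed {\<alpha>. feasible y s \<alpha>}"
  unfolding feasible_def
  by (intro closed_Collect_conj closed_l0_norm_le closed_Collect_eq continuous_intros)

theorem theorem2p2:
  fixes x :: "'m::finite \<Rightarrow> real ^ 'n" and y :: "real ^ 'm"
    and c C :: real and s :: nat
  assumes "\<And>i. y $ i \<in> {-1, 1}"
    and "0 < c" and "c < C"
    and "s \<in> {1..CARD('m)}"
  shows "\<exists>\<alpha>. is_arg_min (D c C x y) (feasible y s) \<alpha>"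
proof -
  \<comment> \<open>Cutting with the ball gives compactness and loses no feasible point where
    \<open>D\<close> is nonpositive.\<close>
  define K where "K = {\<alpha>. feasible y s \<alpha>} \<inter> cball (\<chi> i. C) (sqrt (real CARD('m) * C\<^sup>2))"
  have D0: "D c C x y 0 = 0" by (simp add: D_def h_def)
  have "feasible y s 0" by (simp add: feasible_def l0_norm_def)
  then have "0 \<in> K"
    using D_nonpos_bounded[OF assms(2,3), of x y 0] by (simp add: K_def D0)
  moreover have "compact K"
    unfolding K_def by (intro closed_Int_compact closed_feasible compact_cball)
  ultimately obtain \<alpha> where \<alpha>: "\<alpha> \<in> K" "\<forall>\<beta>\<in>K. D c C x y \<alpha> \<le> D c C x y \<beta>"
    using continuous_attains_inf[of K "D c C x y"] continuous_on_D by blast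
  have "D c C x y \<alpha> \<le> D c C x y \<beta>" if "feasible y s \<beta>" for \<beta>
  \<comment> \<open>A competitor with nonpositive value lies in \<open>K\<close>; any other is
    beaten by 0, which lies in \<open>K\<close> and has value 0.\<close>
  proof (cases "D c C x y \<beta> \<le> 0")
    case True
    then show ?thesis
      using \<alpha>(2) that D_nonpos_bounded[OF assms(2,3) True] by (auto simp: K_def)
  next
    case False
    then show ?thesis
      using \<alpha>(2) \<open>0 \<in> K\<close> D0 by force
  qed
  then show ?thesis
    using \<alpha>(1) by (auto simp: is_arg_min_def K_def not_less)
qed

end
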